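(* Let $R_1$ and $R_2$ be commutative rings with identity. Assume that $\mathrm{AGL}_1(R_1)$ contains a noncommuting pair of elements and that $\mathrm{AGL}_1(R_2)$ contains a noncommuting pair of elements. Then $\mathrm{AGL}_1(R_1\times R_2)$ contains a cross-commuting nonabelian square.
   Context: For a commutative ring $R$ with identity, $\mathrm{AGL}_1(R)$ is the group (under composition) of affine permutations $x\mapsto ax+b$ of $R$ with $a\in R^\times$ and $b\in R$; identifying such a map with the pair $(a,b)$, the composition law is $(a,b)\circ(c,d)=(ac,ad+b)$. A cross-commuting nonabelian square in $\mathrm{AGL}_1(R)$ is a quadruple $(F_0,F_1,G_0,G_1)$ of elements of $\mathrm{AGL}_1(R)$ such that $F_i$ commutes with $G_j$ for all $i,j\in\{0,1\}$, but $F_0$ and $F_1$ do not commute, and $G_0$ and $G_1$ do not commute. *)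

theory Defs
  imports "HOL-Algebra.Algebra"
begin

text \<open>
  Affine maps are extensional functions on the carrier, so that they are elements of
  \<^const>\<open>BijGroup\<close> and equality of maps is equality on the carrier.
\<close>

definition affine_map :: "('a, 'm) ring_scheme \<Rightarrow> 'a \<Rightarrow> 'a \<Rightarrow> 'a \<Rightarrow> 'a"
  where "affine_map R a b = (\<lambda>x \<in> carrier R. a \<otimes>\<^bsub>R\<^esub> x \<oplus>\<^bsub>R\<^esub> b)"

definition AGL1 :: "('a, 'm) ring_scheme \<Rightarrow> ('a \<Rightarrow> 'a) monoid"
  where "AGL1 R = (BijGroup (carrier R))
    \<lparr>carrier := {affine_map R a b | a b. a \<in> Units R \<and> b \<in> carrier R}\<rparr>"

definition commutes :: "('a, 'm) monoid_scheme \<Rightarrow> 'a \<Rightarrow> 'a \<Rightarrow> bool"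
  where "commutes A f g \<longleftrightarrow> f \<otimes>\<^bsub>A\<^esub> g = g \<otimes>\<^bsub>A\<^esub> f"

definition has_noncommuting_pair :: "('a, 'm) monoid_scheme \<Rightarrow> bool"
  where "has_noncommuting_pair A \<longleftrightarrow> (\<exists>f \<in> carrier A. \<exists>g \<in> carrier A. \<not> commutes A f g)"

definition cross_commuting_nonabelian_square ::
    "('a, 'm) monoid_scheme \<Rightarrow> 'a \<times> 'a \<times> 'a \<times> 'a \<Rightarrow> bool"
  where "cross_commuting_nonabelian_square A = (\<lambda>(f\<^sub>0, f\<^sub>1, g\<^sub>0, g\<^sub>1).
    {f\<^sub>0, f\<^sub>1, g\<^sub>0, g\<^sub>1} \<subseteq> carrier A \<and>
    (\<forall>f \<in> {f\<^sub>0, f\<^sub>1}. \<forall>g \<in> {g\<^sub>0, g\<^sub>1}. commutes A f g) \<and>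
    \<not> commutes A f\<^sub>0 f\<^sub>1 \<and> \<not> commutes A g\<^sub>0 g\<^sub>1)"

context cring
begin

lemma affine_map_closed:
  "a \<in> Units R \<Longrightarrow> b \<in> carrier R \<Longrightarrow> x \<in> carrier R \<Longrightarrow> affine_map R a b x \<in> carrier R"
  by (simp add: affine_map_def Units_closed)

lemma affine_map_compose:
  assumes "a \<in> Units R" "b \<in> carrier R" "c \<in> Units R" "d \<in> carrier R"
  shows "compose (carrier R) (affine_map R a b) (affine_map R c d)
    = affine_map R (a \<otimes> c) (a \<otimes> d \<oplus> b)"
proof
  fix x
  show "compose (carrier R) (affine_map R a b) (affine_map R c d) x
    = affine_map R (a \<otimes> c) (a \<otimes> d \<oplus> b) x"
    using assms by (cases "x \<in> carrier R")
      (simp_all add: compose_def affine_map_def Units_closed r_distr m_assoc a_assoc)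
qed

lemma affine_map_one_zero: "affine_map R \<one> \<zero> = (\<lambda>x \<in> carrier R. x)"
  by (auto simp: affine_map_def)

lemma affine_map_inverse:
  assumes "a \<in> Units R" "b \<in> carrier R"
  shows "compose (carrier R) (affine_map R (inv a) (\<ominus> (inv a \<otimes> b))) (affine_map R a b)
      = (\<lambda>x \<in> carrier R. x)"
    and "compose (carrier R) (affine_map R a b) (affine_map R (inv a) (\<ominus> (inv a \<otimes> b)))
      = (\<lambda>x \<in> carrier R. x)"
proof -
  have "inv a \<in> Units R" "inv a \<in> carrier R" "a \<in> carrier R" "\<ominus> (inv a \<otimes> b) \<in> carrier R"
    using assms by (simp_all add: Units_closed)
  moreover have "a \<otimes> \<ominus> (inv a \<otimes> b) = \<ominus> b"
    using assms by (simp add: r_minus Units_closed flip: m_assoc)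
  ultimately show
    "compose (carrier R) (affine_map R (inv a) (\<ominus> (inv a \<otimes> b))) (affine_map R a b)
      = (\<lambda>x \<in> carrier R. x)"
    "compose (carrier R) (affine_map R a b) (affine_map R (inv a) (\<ominus> (inv a \<otimes> b)))
      = (\<lambda>x \<in> carrier R. x)"
    using assms by (simp_all only: affine_map_compose Units_r_inv Units_l_inv r_neg l_neg m_closed
        affine_map_one_zero)
qed

lemma affine_map_Bij:
  assumes "a \<in> Units R" "b \<in> carrier R"
  shows "affine_map R a b \<in> Bij (carrier R)"
proof -
  let ?f = "affine_map R a b" and ?g = "affine_map R (inv a) (\<ominus> (inv a \<otimes> b))"
  have "?g (?f x) = x \<and> ?f (?g x) = x" if "x \<in> carrier R" for x
    using affine_map_inverse[OF assms, THEN fun_cong, of x] that by (simp add: compose_eq)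
  moreover have "?f \<in> carrier R \<rightarrow> carrier R" "?g \<in> carrier R \<rightarrow> carrier R"
    using assms by (auto intro!: affine_map_closed simp: Units_closed)
  ultimately have "bij_betw ?f (carrier R) (carrier R)"
    by (intro bij_betw_byWitness[where f' = ?g]) auto
  then show ?thesis by (simp add: Bij_def affine_map_def)
qed

lemma AGL1_mult:
  assumes "a \<in> Units R" "b \<in> carrier R" "c \<in> Units R" "d \<in> carrier R"
  shows "affine_map R a b \<otimes>\<^bsub>AGL1 R\<^esub> affine_map R c d
    = affine_map R (a \<otimes> c) (a \<otimes> d \<oplus> b)"
  using assms by (simp add: AGL1_def BijGroup_def affine_map_Bij affine_map_compose)

lemma AGL1_subgroup: "subgroup (carrier (AGL1 R)) (BijGroup (carrier R))"
proof (rule group.subgroupI[OF group_BijGroup])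
  show "carrier (AGL1 R) \<subseteq> carrier (BijGroup (carrier R))"
    by (auto simp: AGL1_def BijGroup_def affine_map_Bij)
  show "carrier (AGL1 R) \<noteq> {}"
    by (auto simp: AGL1_def)
next
  fix f assume "f \<in> carrier (AGL1 R)"
  then obtain a b where ab: "a \<in> Units R" "b \<in> carrier R" "f = affine_map R a b"
    by (auto simp: AGL1_def)
  let ?g = "affine_map R (inv a) (\<ominus> (inv a \<otimes> b))"
  have g: "inv a \<in> Units R" "\<ominus> (inv a \<otimes> b) \<in> carrier R"
    using ab by (auto simp: Units_closed)
  have "inv\<^bsub>BijGroup (carrier R)\<^esub> f = ?g"
    using ab g affine_map_Bij affine_map_inverse(1)
    by (intro group.inv_equality[OF group_BijGroup]) (auto simp: BijGroup_def)
  then show "inv\<^bsub>BijGroup (carrier R)\<^esub> f \<in> carrier (AGL1 R)"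
    using g by (auto simp: AGL1_def)
next
  fix f g assume "f \<in> carrier (AGL1 R)" "g \<in> carrier (AGL1 R)"
  then obtain a b c d where h: "a \<in> Units R" "b \<in> carrier R" "f = affine_map R a b"
    "c \<in> Units R" "d \<in> carrier R" "g = affine_map R c d"
    by (auto simp: AGL1_def)
  then have "f \<otimes>\<^bsub>BijGroup (carrier R)\<^esub> g = affine_map R (a \<otimes> c) (a \<otimes> d \<oplus> b)"
    by (simp add: BijGroup_def affine_map_Bij affine_map_compose)
  moreover have "a \<otimes> c \<in> Units R" "a \<otimes> d \<oplus> b \<in> carrier R"
    using h by (auto simp: Units_closed)
  ultimately show "f \<otimes>\<^bsub>BijGroup (carrier R)\<^esub> g \<in> carrier (AGL1 R)"
    by (auto simp: AGL1_def)
qed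

lemma AGL1_group: "group (AGL1 R)"
  using subgroup.subgroup_is_group[OF AGL1_subgroup group_BijGroup]
  by (simp add: AGL1_def)

end

end

theory Submission
  imports Defs
begin

text \<open>
  A noncommuting pair in each factor is extended by the identity on the other factor.
  Maps that move different coordinates commute, while the two maps supported on the same
  coordinate still fail to commute.
\<close>

lemma affine_map_in_AGL1:
  "a \<in> Units R \<Longrightarrow> b \<in> carrier R \<Longrightarrow> affine_map R a b \<in> carrier (AGL1 R)"
  by (auto simp: AGL1_def)

context cring
begin

text \<open>Evaluation at \<open>\<zero>\<close> recovers the translation part; evaluation at
  \<open>\<one>\<close> then recovers the slope by cancellation. Equality of maps thus reduces to
  equality of coefficients.\<close>

lemma affine_map_eq_iff:
  assumes "a \<in> carrier R" "b \<in> carrier R" "c \<in> carrier R" "d \<in> carrier R"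
  shows "affine_map R a b = affine_map R c d \<longleftrightarrow> a = c \<and> b = d"
proof
  assume eq: "affine_map R a b = affine_map R c d"
  have b: "b = d"
    using fun_cong[OF eq, of \<zero>] assms by (simp add: affine_map_def)
  moreover have "a = c"
    using fun_cong[OF eq, of \<one>] assms b by (simp add: affine_map_def)
  ultimately show "a = c \<and> b = d" by simp
qed simp

text \<open>The two composites have slopes \<open>a \<otimes> c\<close> and
  \<open>c \<otimes> a\<close>, which agree because the ring is commutative, so only their
  translation parts can differ.\<close>

lemma commutes_affine_map_iff:
  assumes "a \<in> Units R" "b \<in> carrier R" "c \<in> Units R" "d \<in> carrier R"
  shows "commutes (AGL1 R) (affine_map R a b) (affine_map R c d)
    \<longleftrightarrow> a \<otimes> d \<oplus> b = c \<otimes> b \<oplus> d"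
  using assms by (simp add: commutes_def AGL1_mult affine_map_eq_iff Units_closed m_comm)

text \<open>Replaces the two maps by coefficients, which, unlike the maps themselves, can be placed
  directly into a component of the product ring.\<close>

lemma has_noncommuting_pair_AGL1E:
  assumes "has_noncommuting_pair (AGL1 R)"
  obtains a b c d where "a \<in> Units R" "b \<in> carrier R" "c \<in> Units R" "d \<in> carrier R"
    "a \<otimes> d \<oplus> b \<noteq> c \<otimes> b \<oplus> d"
  using assms commutes_affine_map_iff by (auto simp: has_noncommuting_pair_def AGL1_def)

end

lemma RDirProd_ops:
  "(a, b) \<otimes>\<^bsub>RDirProd R S\<^esub> (c, d) = (a \<otimes>\<^bsub>R\<^esub> c, b \<otimes>\<^bsub>S\<^esub> d)"
  "(a, b) \<oplus>\<^bsub>RDirProd R S\<^esub> (c, d) = (a \<oplus>\<^bsub>R\<^esub> c, b \<oplus>\<^bsub>S\<^esub> d)"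
  "\<one>\<^bsub>RDirProd R S\<^esub> = (\<one>\<^bsub>R\<^esub>, \<one>\<^bsub>S\<^esub>)"
  by (simp_all add: RDirProd_def DirProd_def monoid.defs)

lemma RDirProd_cring:
  assumes "cring R" and "cring S"
  shows "cring (RDirProd R S)"
proof -
  interpret R: cring R by fact
  interpret S: cring S by fact
  interpret ring "RDirProd R S" by (rule RDirProd_ring) unfold_locales
  show ?thesis
    by unfold_locales (auto simp: RDirProd_carrier RDirProd_ops R.m_comm S.m_comm)
qed

text \<open>The pair of the two inverses is an inverse.\<close>

lemma RDirProd_UnitsI:
  assumes "a \<in> Units R" and "b \<in> Units S"
  shows "(a, b) \<in> Units (RDirProd R S)"
  using assms by (fastforce simp: Units_def RDirProd_carrier RDirProd_ops)

theorem theorem4p1: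
  fixes R\<^sub>1 :: "('a, 'm) ring_scheme" and R\<^sub>2 :: "('b, 'n) ring_scheme"
  assumes "cring R\<^sub>1" and "cring R\<^sub>2"
    and "has_noncommuting_pair (AGL1 R\<^sub>1)"
    and "has_noncommuting_pair (AGL1 R\<^sub>2)"
  shows "\<exists>q. cross_commuting_nonabelian_square (AGL1 (RDirProd R\<^sub>1 R\<^sub>2)) q"
proof -
  let ?S = "RDirProd R\<^sub>1 R\<^sub>2"
  interpret R1: cring R\<^sub>1 by fact
  interpret R2: cring R\<^sub>2 by fact
  interpret S: cring ?S by (rule RDirProd_cring) fact+
  obtain a b c d where 1: "a \<in> Units R\<^sub>1" "b \<in> carrier R\<^sub>1" "c \<in> Units R\<^sub>1" "d \<in> carrier R\<^sub>1"
    "a \<otimes>\<^bsub>R\<^sub>1\<^esub> d \<oplus>\<^bsub>R\<^sub>1\<^esub> b \<noteq> c \<otimes>\<^bsub>R\<^sub>1\<^esub> b \<oplus>\<^bsub>R\<^sub>1\<^esub> d"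
    using R1.has_noncommuting_pair_AGL1E assms(3) by blast
  obtain a' b' c' d' where 2: "a' \<in> Units R\<^sub>2" "b' \<in> carrier R\<^sub>2" "c' \<in> Units R\<^sub>2" "d' \<in> carrier R\<^sub>2"
    "a' \<otimes>\<^bsub>R\<^sub>2\<^esub> d' \<oplus>\<^bsub>R\<^sub>2\<^esub> b' \<noteq> c' \<otimes>\<^bsub>R\<^sub>2\<^esub> b' \<oplus>\<^bsub>R\<^sub>2\<^esub> d'"
    using R2.has_noncommuting_pair_AGL1E assms(4) by blast
  \<comment> \<open>Slope one and translation zero in a component give the identity there, so
    \<open>left\<close> moves only the first coordinate and \<open>right\<close> only the
    second.\<close>
  define left where "left = (\<lambda>x y. affine_map ?S (x, \<one>\<^bsub>R\<^sub>2\<^esub>) (y, \<zero>\<^bsub>R\<^sub>2\<^esub>))"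
  define right where "right = (\<lambda>x y. affine_map ?S (\<one>\<^bsub>R\<^sub>1\<^esub>, x) (\<zero>\<^bsub>R\<^sub>1\<^esub>, y))"
  note simps = R1.Units_closed R2.Units_closed RDirProd_UnitsI RDirProd_carrier RDirProd_ops
  have "{left a b, left c d, right a' b', right c' d'} \<subseteq> carrier (AGL1 ?S)"
    using 1(1-4) 2(1-4)
    by (auto simp: left_def right_def RDirProd_carrier intro!: affine_map_in_AGL1 RDirProd_UnitsI)
  \<comment> \<open>In either order the translation part of the composite is \<open>(y, y')\<close>.
    Arbitrary parameters cover all four cross pairs at once.\<close>
  moreover have "commutes (AGL1 ?S) (left x y) (right x' y')"
    if "x \<in> Units R\<^sub>1" "y \<in> carrier R\<^sub>1" "x' \<in> Units R\<^sub>2" "y' \<in> carrier R\<^sub>2" for x y x' y'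
    unfolding left_def right_def using that
    by (subst S.commutes_affine_map_iff)
      (simp_all add: simps)
  \<comment> \<open>The second components of both translation parts are zero; the first components
    are the two sides of the inequality in \<open>1\<close>.\<close>
  moreover have "\<not> commutes (AGL1 ?S) (left a b) (left c d)"
    unfolding left_def using 1
    by (subst S.commutes_affine_map_iff) (simp_all add: simps)
  moreover have "\<not> commutes (AGL1 ?S) (right a' b') (right c' d')"
    unfolding right_def using 2
    by (subst S.commutes_affine_map_iff) (simp_all add: simps)
  ultimately have "cross_commuting_nonabelian_square (AGL1 ?S)
      (left a b, left c d, right a' b', right c' d')"
    using 1(1-4) 2(1-4) by (simp add: cross_commuting_nonabelian_square_def)
  then show ?thesis ..
qed

end
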